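(* Let $r:[-\tfrac12,1]\to[-1,1]$ be the function defined by $$r(x)=\begin{cases}2x+\frac12-\frac{\sqrt3}{9}(1+2x)^{3/2}; & x\in[-\frac12,-\frac18],\\[2pt] \frac43x+\frac7{24}; & x\in[-\frac18,\frac14],\\[2pt] \dfrac{2n+1}{n^2+n}\,x+\dfrac{2n^2-2n+1}{2(n^2+n)}; & x\in\bigl[1-\frac{3}{2n},\,1-\frac{3}{2(n+1)}\bigr],\ n=2,3,\dots,\\[2pt] 1; & x=1.\end{cases}$$ Then for every $x\in[-\tfrac12,1]$ there exists a bivariate copula $C$ such that $\phi(C)=x$ and $\rho(C)=r(x)$.
   Context: Let $\mathbb I=[0,1]$. A bivariate copula is a function $C:\mathbb I^2\to\mathbb I$ with $C(0,v)=C(u,0)=0$, $C(u,1)=u$, $C(1,v)=v$ for all $u,v\in\mathbb I$, and $C(u_2,v_2)-C(u_2,v_1)-C(u_1,v_2)+C(u_1,v_1)\ge 0$ whenever $0\le u_1\le u_2\le 1$, $0\le v_1\le v_2\le 1$. Spearman's rho is $\rho(C)=12\int_{\mathbb I^2}C(u,v)\,du\,dv-3$ and Spearman's footrule is $\phi(C)=6\int_0^1C(u,u)\,du-2$. *)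

theory Defs
  imports "HOL-Analysis.Analysis"
begin

text \<open>
  A copula is a function on the closed unit square; here it is a total curried function on the
  reals whose values outside the unit square are irrelevant.
\<close>

definition copula :: "(real \<Rightarrow> real \<Rightarrow> real) \<Rightarrow> bool" where
  "copula C \<longleftrightarrow>
     (\<forall>u\<in>{0..1}. \<forall>v\<in>{0..1}. C u v \<in> {0..1}) \<and>
     (\<forall>v\<in>{0..1}. C 0 v = 0) \<and>
     (\<forall>u\<in>{0..1}. C u 0 = 0) \<and>
     (\<forall>u\<in>{0..1}. C u 1 = u) \<and>
     (\<forall>v\<in>{0..1}. C 1 v = v) \<and>
     (\<forall>u1 u2 v1 v2. 0 \<le> u1 \<and> u1 \<le> u2 \<and> u2 \<le> 1 \<and> 0 \<le> v1 \<and> v1 \<le> v2 \<and> v2 \<le> 1 \<longrightarrow>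
        C u2 v2 - C u2 v1 - C u1 v2 + C u1 v1 \<ge> 0)"

text \<open>
  Copulas are Lipschitz continuous on the unit square, so for them both integrands below are
  integrable and the value does not depend on the choice of integral.
\<close>

definition spearman_rho :: "(real \<Rightarrow> real \<Rightarrow> real) \<Rightarrow> real" where
  "spearman_rho C = 12 * integral ({0..1} \<times> {0..1}) (\<lambda>(u, v). C u v) - 3"

definition spearman_footrule :: "(real \<Rightarrow> real \<Rightarrow> real) \<Rightarrow> real" where
  "spearman_footrule C = 6 * integral {0..1} (\<lambda>u. C u u) - 2"

definition r_interval :: "nat \<Rightarrow> real set" where
  "r_interval n = {1 - 3 / (2 * real n) .. 1 - 3 / (2 * (real n + 1))}"

definition r_piece :: "nat \<Rightarrow> real \<Rightarrow> real" where
  "r_piece n x = (2 * real n + 1) / ((real n)^2 + real n) * x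
     + (2 * (real n)^2 - 2 * real n + 1) / (2 * ((real n)^2 + real n))"

text \<open>
  Consecutive pieces overlap in an endpoint, so the definition has to pick one of them. By
  \<open>r_fun_first\<close>, \<open>r_fun_second\<close> and \<open>r_fun_piece\<close> below, every clause of the case distinction
  holds on its whole closed interval, and by \<open>r_domain_cover\<close> the intervals exhaust the domain.
\<close>

definition r_fun :: "real \<Rightarrow> real" where
  "r_fun x =
     (if x \<in> {-1/2 .. -1/8} then 2 * x + 1/2 - sqrt 3 / 9 * (1 + 2 * x) powr (3/2)
      else if x \<in> {-1/8 .. 1/4} then 4/3 * x + 7/24
      else if x = 1 then 1
      else r_piece (LEAST n. 2 \<le> n \<and> x \<in> r_interval n) x)"

lemma r_fun_first:
  "x \<in> {-1/2 .. -1/8} \<Longrightarrow> r_fun x = 2 * x + 1/2 - sqrt 3 / 9 * (1 + 2 * x) powr (3/2)"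
  by (simp add: r_fun_def)

lemma r_fun_second:
  assumes "x \<in> {-1/8 .. 1/4}"
  shows "r_fun x = 4/3 * x + 7/24"
proof (cases "x = -1/8")
  case True
  have "(3/4::real) powr (3/2) = (3/4) powr 1 * (3/4) powr (1/2)"
    by (simp only: powr_add [symmetric]) simp
  also have "\<dots> = 3/4 * (sqrt 3 / 2)"
    by (simp add: powr_half_sqrt real_sqrt_divide)
  finally have "(3/4::real) powr (3/2) = 3/4 * (sqrt 3 / 2)" .
  then have "sqrt 3 * (3/4::real) powr (3/2) = sqrt 3 * (3/4 * (sqrt 3 / 2))"
    by (simp only:)
  also have "\<dots> = 9/8"
    by simp
  finally have "sqrt 3 * (3/4::real) powr (3/2) = 9/8" .
  then show ?thesis
    using True by (simp add: r_fun_def)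
next
  case False
  then show ?thesis
    using assms by (simp add: r_fun_def)
qed

lemma r_fun_one: "r_fun 1 = 1"
  by (simp add: r_fun_def)

lemma r_piece_left:
  assumes "n \<ge> 1"
  shows "r_piece n (1 - 3 / (2 * real n)) = 1 - 3 / (2 * (real n)^2)"
proof -
  define a where "a = real n"
  have a: "a \<noteq> 0" "a + 1 \<noteq> 0"
    using assms by (auto simp: a_def)
  have fac: "a^2 + a = a * (a + 1)"
    by (simp add: power2_eq_square algebra_simps)
  show ?thesis
    unfolding r_piece_def a_def [symmetric] fac using a
    by (simp add: divide_simps del: distrib_left_numeral)
       (simp add: algebra_simps power2_eq_square)
qed

lemma r_piece_right:
  assumes "n \<ge> 1"
  shows "r_piece n (1 - 3 / (2 * (real n + 1))) = 1 - 3 / (2 * (real n + 1)^2)"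
proof -
  define a where "a = real n"
  have a: "a \<noteq> 0" "a + 1 \<noteq> 0"
    using assms by (auto simp: a_def)
  have fac: "a^2 + a = a * (a + 1)"
    by (simp add: power2_eq_square algebra_simps)
  show ?thesis
    unfolding r_piece_def a_def [symmetric] fac using a
    by (simp add: divide_simps del: distrib_left_numeral)
       (simp add: algebra_simps power2_eq_square)
qed

lemma r_interval_overlap:
  assumes "1 \<le> n" "n < m" "x \<in> r_interval n" "x \<in> r_interval m"
  shows "m = Suc n \<and> x = 1 - 3 / (2 * (real n + 1))"
proof -
  have 1: "x \<le> 1 - 3 / (2 * (real n + 1))" "1 - 3 / (2 * real m) \<le> x"
    using assms by (auto simp: r_interval_def)
  then have "3 / (2 * (real n + 1)) \<le> 3 / (2 * real m)"
    by linarith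
  then have "real m \<le> real n + 1"
    using assms(1,2) by (simp add: divide_simps split: if_splits)
  then have "m = Suc n"
    using assms(2) by linarith
  then show ?thesis
    using 1 by (simp add: add.commute)
qed

lemma r_fun_piece:
  assumes n: "2 \<le> n" and x: "x \<in> r_interval n"
  shows "r_fun x = r_piece n x"
proof -
  let ?P = "\<lambda>n. 2 \<le> n \<and> x \<in> r_interval n"
  have "3 / (2 * real n) \<le> 3 / 4"
    using n by (simp add: divide_simps)
  then have lo: "1/4 \<le> x"
    using x by (auto simp: r_interval_def)
  have "3 / (2 * (real n + 1)) > 0"
    by (intro divide_pos_pos) auto
  then have hi: "x < 1"
    using x unfolding r_interval_def atLeastAtMost_iff by linarith
  show ?thesis
  proof (cases "x = 1/4")
    case True
    have "n = 2"
    proof (rule ccontr)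
      assume "n \<noteq> 2"
      then have "3 / (2 * real n) < 3 / 4"
        using n by (simp add: divide_simps)
      then show False
        using x True by (auto simp: r_interval_def)
    qed
    then show ?thesis
      using True r_fun_second [of x] by (simp add: r_piece_def)
  next
    case False
    define m where "m = (LEAST n. ?P n)"
    have m: "?P m"
      unfolding m_def by (rule LeastI [of ?P n]) (use n x in simp)
    have mn: "m \<le> n"
      unfolding m_def by (rule Least_le) (use n x in simp)
    have "r_fun x = r_piece m x"
      using lo hi False by (simp add: r_fun_def m_def)
    also have "\<dots> = r_piece n x"
    proof (cases "m = n")
      case False
      then have "m < n" using mn by simp
      then have *: "n = Suc m" "x = 1 - 3 / (2 * (real m + 1))"
        using r_interval_overlap [of m n x] m x by auto
      then show ?thesis
        using r_piece_right [of m] r_piece_left [of n] m by (simp add: add.commute)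
    qed simp
    finally show ?thesis .
  qed
qed

lemma r_interval_exists:
  assumes "1/4 \<le> x" "x < 1"
  shows "\<exists>n\<ge>2. x \<in> r_interval n"
proof -
  define y where "y = 3 / (2 * (1 - x))"
  have y: "y \<ge> 2" and xy: "x = 1 - 3 / (2 * y)"
    using assms by (auto simp: y_def divide_simps)
  define n where "n = nat \<lfloor>y\<rfloor>"
  have n: "n \<ge> 2" "real n \<le> y" "y \<le> real n + 1"
    using y unfolding n_def by linarith+
  then have "3 / (2 * y) \<le> 3 / (2 * real n)" "3 / (2 * (real n + 1)) \<le> 3 / (2 * y)"
    using y by (auto intro!: divide_left_mono)
  then show ?thesis
    using n(1) xy by (auto simp: r_interval_def)
qed

lemma r_domain_cover:
  assumes "x \<in> {-1/2 .. 1}"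
  shows "x \<in> {-1/2 .. -1/8} \<or> x \<in> {-1/8 .. 1/4} \<or> (\<exists>n\<ge>2. x \<in> r_interval n) \<or> x = 1"
  using assms r_interval_exists [of x] by force

lemma r_fun_range:
  assumes "x \<in> {-1/2 .. 1}"
  shows "r_fun x \<in> {-1 .. 1}"
  using r_domain_cover [OF assms]
proof (elim disjE exE conjE)
  assume x: "x \<in> {-1/2 .. -1/8}"
  have "(1 + 2 * x) powr (3/2) \<le> 1 powr (3/2)"
    using x by (intro powr_mono2) auto
  moreover have "sqrt 3 \<le> 2"
    by (rule real_le_lsqrt) auto
  ultimately have "sqrt 3 / 9 * (1 + 2 * x) powr (3/2) \<le> 2 / 9 * 1"
    by (intro mult_mono) auto
  moreover have "0 \<le> sqrt 3 / 9 * (1 + 2 * x) powr (3/2)"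
    by simp
  moreover have "-1/2 \<le> x" "x \<le> -1/8"
    using x by auto
  ultimately show ?thesis
    unfolding r_fun_first [OF x] atLeastAtMost_iff by linarith
next
  assume "x \<in> {-1/8 .. 1/4}"
  then show ?thesis
    by (auto simp: r_fun_second)
next
  fix n :: nat
  assume n: "2 \<le> n" and x: "x \<in> r_interval n"
  have slope: "(2 * real n + 1) / ((real n)^2 + real n) \<ge> 0"
    by simp
  have "r_piece n (1 - 3 / (2 * real n)) \<le> r_piece n x"
    "r_piece n x \<le> r_piece n (1 - 3 / (2 * (real n + 1)))"
    using x unfolding r_piece_def r_interval_def atLeastAtMost_iff
    by (blast intro: add_right_mono mult_left_mono [OF _ slope])+
  moreover have "3 / (2 * (real n)^2) \<le> 1"
  proof -
    have "(2::real)^2 \<le> (real n)^2"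
      using n by (intro power_mono) auto
    then show ?thesis
      using n by (simp add: divide_simps)
  qed
  moreover have "0 \<le> 3 / (2 * (real n + 1)^2)"
    by simp
  ultimately have "-1 \<le> r_piece n x" "r_piece n x \<le> 1"
    using n r_piece_left [of n] r_piece_right [of n] by linarith+
  then show ?thesis
    using r_fun_piece [OF n x] by simp
next
  assume "x = 1"
  then show ?thesis
    by (simp add: r_fun_one)
qed

end

theory Submission
  imports Defs
begin

text \<open>
  If \<open>(U, V)\<close> has distribution function \<open>C\<close>, then \<open>\<phi>(C) = 1 - 3 E|U - V|\<close> and
  \<open>\<rho>(C) = 1 - 6 E(U - V)\<^sup>2\<close>. Hence, if \<open>\<phi>(C) = x\<close>, then
  \<open>\<rho>(C) = 1 - 2/3 (1 - x)\<^sup>2 - 6 Var|U - V|\<close>, and the graph of \<open>r\<close> is traced out by couplings for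
  which \<open>|U - V|\<close> varies little:

  \<^item> At \<open>x = 1 - 3/(2n)\<close> the distance \<open>|U - V|\<close> is constantly \<open>1/(2n)\<close>: cut the unit interval into
    \<open>2n\<close> blocks of equal length and exchange neighbouring blocks in pairs
    (\<open>realizable_block_swap\<close>). This gives \<open>\<rho> = 1 - 3/(2n\<^sup>2)\<close>.

  \<^item> On \<open>[-1/2, -1/8]\<close> put \<open>s = sqrt ((1 + 2x)/3)\<close>, which runs through \<open>[0, 1/2]\<close>. For
    \<open>s > 0\<close> a constant distance is no longer possible; instead \<open>1/2 - |U - V|\<close> vanishes with probability \<open>1 - 2s\<close> and is
    otherwise uniform on \<open>[0, s/2]\<close>. Such a coupling is supported on segments of slope \<open>2\<close>, \<open>1\<close> and
    \<open>1/2\<close> above the diagonal and on their mirror images (\<open>realizable_curve\<close>).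

  \<^item> On the remaining intervals \<open>r\<close> is affine between consecutive points of these two kinds. Both
    \<open>\<phi>\<close> and \<open>\<rho>\<close> are affine in \<open>C\<close>, so convex combinations of copulas fill in the chords
    (\<open>realizable_convex\<close>).

  At \<open>x = 1\<close> the coupling is \<open>U = V\<close>. All these copulas, apart from the convex combinations, are
  symmetric mixtures of uniform distributions on line segments. The locale \<open>segment_coupling\<close>
  treats these once and for all, and \<open>realizable_mix\<close> expresses their two coefficients through the
  segments.
\<close>

section \<open>Distribution functions of uniform variables\<close>

text \<open>For \<open>p > 0\<close>, the distribution function of the uniform distribution on \<open>[a, a + p]\<close>.\<close>

definition ramp :: "real \<Rightarrow> real \<Rightarrow> real \<Rightarrow> real" where
  "ramp a p u = max 0 (min 1 ((u - a) / p))"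

lemma ramp_bounds: "0 \<le> ramp a p u" "ramp a p u \<le> 1"
  by (auto simp: ramp_def)

lemma ramp_mono: "0 < p \<Longrightarrow> u \<le> v \<Longrightarrow> ramp a p u \<le> ramp a p v"
  unfolding ramp_def by (intro max.mono min.mono divide_right_mono) auto

lemma ramp_below: "0 < p \<Longrightarrow> u \<le> a \<Longrightarrow> ramp a p u = 0"
  by (auto simp: ramp_def divide_simps max_def min_def)

lemma ramp_above: "0 < p \<Longrightarrow> a + p \<le> u \<Longrightarrow> ramp a p u = 1"
  by (auto simp: ramp_def divide_simps max_def min_def)

lemma ramp_between: "0 < p \<Longrightarrow> a \<le> u \<Longrightarrow> u \<le> a + p \<Longrightarrow> ramp a p u = (u - a) / p"
  by (auto simp: ramp_def divide_simps max_def min_def)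

text \<open>Adding mass \<open>p\<close>, spread uniformly over \<open>[a, a + p]\<close>, to Lebesgue measure on \<open>[0, a]\<close> prolongs
  the latter. This is how uniform marginals are verified below. In the degenerate case \<open>p = 0\<close> nothing is added.\<close>

lemma ramp_stack: "0 \<le> p \<Longrightarrow> min u a + p * ramp a p u = min u (a + p)"
  by (cases "p = 0") (auto simp: ramp_def max_def min_def field_simps)

lemma continuous_on_ramp [continuous_intros]:
  "continuous_on S f \<Longrightarrow> continuous_on S (\<lambda>x. ramp a p (f x))"
  unfolding ramp_def divide_inverse by (intro continuous_intros)

text \<open>Stochastic order: moving both end points of the interval to the right lowers the
  distribution function.\<close>

lemma ramp_antimono_interval:
  assumes "0 < p" "0 < q" "a \<le> b" "a + p \<le> b + q"
  shows "ramp b q u \<le> ramp a p u"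
proof (cases "u \<le> b \<or> a + p \<le> u")
  case True
  then show ?thesis
    using assms ramp_bounds by (auto simp: ramp_below ramp_above)
next
  case False
  have "p * (u - b) \<le> q * (u - a)"
  proof (cases "p \<le> q")
    case True
    then show ?thesis
      using False assms by (intro mult_mono) auto
  next
    case False2: False
    \<comment> \<open>The distances to the right end points are compared instead.\<close>
    have "q * (a + p - u) \<le> p * (b + q - u)"
      using False False2 assms by (intro mult_mono) auto
    then show ?thesis
      by (simp add: algebra_simps)
  qed
  then have "(u - b) / q \<le> (u - a) / p"
    using assms by (simp add: field_simps)
  then show ?thesis
    using False assms by (simp add: ramp_between)
qed

lemma has_integral_ramp_split:
  fixes g :: "real \<Rightarrow> real \<Rightarrow> real"
  assumes "0 \<le> a" "0 < p" "a + p \<le> 1"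
    and "((\<lambda>u. g u 0) has_integral I) {0..a}"
    and "((\<lambda>u. g u ((u - a) / p)) has_integral J) {a..a + p}"
    and "((\<lambda>u. g u 1) has_integral K) {a + p..1}"
  shows "((\<lambda>u. g u (ramp a p u)) has_integral (I + J + K)) {0..1}"
proof (rule has_integral_combine [of 0 "a + p" 1])
  show "((\<lambda>u. g u (ramp a p u)) has_integral (I + J)) {0..a + p}"
  proof (rule has_integral_combine [of 0 a "a + p"])
    show "((\<lambda>u. g u (ramp a p u)) has_integral I) {0..a}"
      using assms by (intro has_integral_eq [OF _ assms(4)]) (auto simp: ramp_below)
    show "((\<lambda>u. g u (ramp a p u)) has_integral J) {a..a + p}"
      using assms by (intro has_integral_eq [OF _ assms(5)]) (auto simp: ramp_between)
  qed (use assms in auto)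
  show "((\<lambda>u. g u (ramp a p u)) has_integral K) {a + p..1}"
    using assms by (intro has_integral_eq [OF _ assms(6)]) (auto simp: ramp_above)
qed (use assms in auto)

lemma has_integral_antiderivative:
  fixes f :: "real \<Rightarrow> real"
  assumes "a \<le> b" "\<And>x. (F has_real_derivative f x) (at x)" "F b - F a = I"
  shows "(f has_integral I) {a..b}"
  using fundamental_theorem_of_calculus [OF assms(1), of F f] assms(2,3)
  by (auto simp: has_real_derivative_iff_has_vector_derivative
      intro: has_vector_derivative_at_within)

lemma has_integral_ramp:
  assumes "0 \<le> a" "0 < p" "a + p \<le> 1"
  shows "(ramp a p has_integral (1 - a - p / 2)) {0..1}"
proof -
  have J: "((\<lambda>u. (u - a) / p) has_integral p / 2) {a..a + p}"
    by (rule has_integral_antiderivative [where F = "\<lambda>u. (u - a)^2 / (2 * p)"])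
      (use assms in \<open>auto intro!: derivative_eq_intros simp: power2_eq_square field_simps\<close>)
  have K: "((\<lambda>u. 1) has_integral (1 - a - p)) {a + p..1}"
    using assms has_integral_const_real [of "1::real" "a + p" 1] by (simp add: diff_diff_eq)
  show ?thesis
    using has_integral_ramp_split [OF assms, of "\<lambda>u y. y", OF _ J K, of 0]
    by (simp add: algebra_simps)
qed

lemma has_integral_ramp_square:
  assumes "0 \<le> a" "0 < p" "a + p \<le> 1"
  shows "((\<lambda>u. (ramp a p u)^2) has_integral (1 - a - 2 * p / 3)) {0..1}"
proof -
  have J: "((\<lambda>u. ((u - a) / p)^2) has_integral p / 3) {a..a + p}"
    by (rule has_integral_antiderivative [where F = "\<lambda>u. (u - a)^3 / (3 * p^2)"])
      (use assms in \<open>auto intro!: derivative_eq_intros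
        simp: power2_eq_square power3_eq_cube field_simps\<close>)
  have K: "((\<lambda>u. 1) has_integral (1 - a - p)) {a + p..1}"
    using assms has_integral_const_real [of "1::real" "a + p" 1] by (simp add: diff_diff_eq)
  show ?thesis
    using has_integral_ramp_split [OF assms, of "\<lambda>u y. y^2" 0, OF _ J, of "1 - a - p"] K
    by (simp add: algebra_simps)
qed

text \<open>This is half the second moment of \<open>1 - U\<close> for \<open>U\<close> uniform on \<open>[a, a + p]\<close>.\<close>

lemma has_integral_ramp_moment:
  assumes "0 \<le> a" "0 < p" "a + p \<le> 1"
  shows "((\<lambda>u. (1 - u) * ramp a p u) has_integral
    ((1 - a)^2 - p * (1 - a) + p^2 / 3) / 2) {0..1}"
proof -
  have J: "((\<lambda>u. (1 - u) * ((u - a) / p)) has_integral ((1 - a) * p / 2 - p^2 / 3)) {a..a + p}"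
    by (rule has_integral_antiderivative
        [where F = "\<lambda>u. (1 - a) * (u - a)^2 / (2 * p) - (u - a)^3 / (3 * p)"])
      (use assms in \<open>auto intro!: derivative_eq_intros
        simp: power2_eq_square power3_eq_cube field_simps\<close>)
  have K: "((\<lambda>u. (1 - u) * 1) has_integral (1 - a - p)^2 / 2) {a + p..1}"
    by (rule has_integral_antiderivative [where F = "\<lambda>u. - ((1 - u)^2) / 2"])
      (use assms in \<open>auto intro!: derivative_eq_intros simp: field_simps\<close>)
  have "0 + ((1 - a) * p / 2 - p^2 / 3) + (1 - a - p)^2 / 2
      = ((1 - a)^2 - p * (1 - a) + p^2 / 3) / 2"
    by (simp add: power2_eq_square field_simps)
  then show ?thesis
    using has_integral_ramp_split [OF assms, of "\<lambda>u y. (1 - u) * y", OF _ J K, of 0]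
    by (simp only: mult_zero_right has_integral_0)
qed

text \<open>Truncating a ramp at height \<open>y\<close> shortens its interval by the factor \<open>y\<close> and leaves a
  rescaled ramp, whose integral is known.\<close>

lemma integral_min_ramp:
  assumes "0 \<le> a" "0 < p" "a + p \<le> 1" "0 \<le> y" "y \<le> 1"
  shows "integral {0..1} (\<lambda>u. min (ramp a p u) y) = (1 - a) * y - p / 2 * y^2"
proof (cases "y = 0")
  case True
  then show ?thesis
    by (simp add: min_absorb2 ramp_bounds)
next
  case False
  then have y: "0 < y"
    using assms by simp
  have "p * y \<le> p * 1"
    using assms by (intro mult_left_mono) auto
  then have "(ramp a (p * y) has_integral (1 - a - p * y / 2)) {0..1}"
    using assms y by (intro has_integral_ramp) (auto intro: order_trans [of _ "a + p"])
  then have "((\<lambda>u. y * ramp a (p * y) u) has_integral y * (1 - a - p * y / 2)) {0..1}"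
    by (rule has_integral_mult_right)
  moreover have "y * ramp a (p * y) u = min (ramp a p u) y" for u
  proof -
    have "y * max 0 (min 1 (z / y)) = min (max 0 (min 1 z)) y" for z :: real
      using y \<open>y \<le> 1\<close> by (auto simp: max_def min_def divide_simps)
    from this [of "(u - a) / p"] show ?thesis
      by (simp add: ramp_def)
  qed
  ultimately show ?thesis
    by (simp add: integral_unique power2_eq_square algebra_simps)
qed

section \<open>A uniform distribution on a line segment\<close>

text \<open>The distribution function of \<open>(a + p T, b + q T)\<close> with \<open>T\<close> uniform on the unit interval.\<close>

definition segment :: "real \<Rightarrow> real \<Rightarrow> real \<Rightarrow> real \<Rightarrow> real \<Rightarrow> real \<Rightarrow> real" where
  "segment a p b q u v = min (ramp a p u) (ramp b q v)"

lemma continuous_on_segment [continuous_intros]: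
  "continuous_on S f \<Longrightarrow> continuous_on S g \<Longrightarrow> continuous_on S (\<lambda>x. segment a p b q (f x) (g x))"
  unfolding segment_def by (intro continuous_intros)

lemma segment_sym: "segment b q a p v u = segment a p b q u v"
  by (simp add: segment_def min.commute)

lemma segment_rectangle:
  assumes "0 < p" "0 < q" "u1 \<le> u2" "v1 \<le> v2"
  shows "0 \<le> segment a p b q u2 v2 - segment a p b q u2 v1
    - segment a p b q u1 v2 + segment a p b q u1 v1"
  using ramp_mono [OF assms(1,3), of a] ramp_mono [OF assms(2,4), of b]
  by (auto simp: segment_def min_def)

lemma segment_diagonal:
  assumes "0 < p" "0 < q" "a \<le> b" "a + p \<le> b + q"
  shows "segment a p b q u u = ramp b q u"
  using ramp_antimono_interval [OF assms, of u] by (simp add: segment_def)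

text \<open>With \<open>A = 1 - a - p T\<close> and \<open>B = 1 - b - q T\<close>, the value is \<open>E(A B)\<close>.\<close>

lemma integral_segment:
  assumes "0 \<le> a" "0 < p" "a + p \<le> 1" "0 \<le> b" "0 < q" "b + q \<le> 1"
  shows "integral ({0..1} \<times> {0..1}) (\<lambda>(u, v). segment a p b q u v) =
    (1 - a) * (1 - b) - (q * (1 - a) + p * (1 - b)) / 2 + p * q / 3"
proof -
  have "integral ({0..1} \<times> {0..1}) (\<lambda>(u, v). segment a p b q u v)
      = integral (cbox (0, 0) (1, 1)) (\<lambda>z. segment a p b q (fst z) (snd z))"
    by (simp add: cbox_Pair_eq case_prod_unfold)
  also have "\<dots> = integral {0..1} (\<lambda>u. integral {0..1} (\<lambda>v. segment a p b q u v))"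
    by (subst integral_prod_continuous) (auto intro!: continuous_intros)
  also have "\<dots> = integral {0..1} (\<lambda>u. (1 - b) * ramp a p u - q / 2 * (ramp a p u)^2)"
    using integral_min_ramp [OF assms(4-6) ramp_bounds]
    by (simp add: segment_def min.commute)
  also have "\<dots> = (1 - b) * (1 - a - p / 2) - q / 2 * (1 - a - 2 * p / 3)"
    using assms
    by (intro integral_unique has_integral_diff has_integral_mult_right
        has_integral_ramp has_integral_ramp_square) auto
  also have "\<dots> = (1 - a) * (1 - b) - (q * (1 - a) + p * (1 - b)) / 2 + p * q / 3"
    by (simp add: field_simps)
  finally show ?thesis .
qed

section \<open>Realizable pairs of coefficients\<close>

text \<open>Integrability is recorded in order that the two coefficients are affine under mixing.\<close>

definition realizable :: "real \<Rightarrow> real \<Rightarrow> bool" where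
  "realizable x y \<longleftrightarrow> (\<exists>C. copula C
     \<and> (\<lambda>u. C u u) integrable_on {0..1}
     \<and> (\<lambda>(u, v). C u v) integrable_on ({0..1} \<times> {0..1})
     \<and> spearman_footrule C = x \<and> spearman_rho C = y)"

lemma copula_convex:
  assumes C: "copula C" and D: "copula D" and t: "0 \<le> t" "t \<le> 1"
  shows "copula (\<lambda>u v. t * C u v + (1 - t) * D u v)"
proof -
  have "t * c + (1 - t) * d \<in> {0..1}" if "c \<in> {0..1}" "d \<in> {0..1}" for c d :: real
    using that t convex_bound_le [of c 1 d t "1 - t"] by auto
  moreover have "0 \<le> (t * c22 + (1 - t) * d22) - (t * c21 + (1 - t) * d21)
      - (t * c12 + (1 - t) * d12) + (t * c11 + (1 - t) * d11)"
    if "0 \<le> c22 - c21 - c12 + c11" "0 \<le> d22 - d21 - d12 + d11"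
    for c22 c21 c12 c11 d22 d21 d12 d11 :: real
  proof -
    have "0 \<le> t * (c22 - c21 - c12 + c11) + (1 - t) * (d22 - d21 - d12 + d11)"
      using that t
      by (intro add_nonneg_nonneg [OF mult_nonneg_nonneg mult_nonneg_nonneg]) simp_all
    then show ?thesis
      by (simp add: algebra_simps)
  qed
  moreover have "t * u + (1 - t) * u = u" for u :: real
    by (simp add: algebra_simps)
  ultimately show ?thesis
    using C D unfolding copula_def by simp
qed

lemma realizable_convex:
  assumes "realizable x y" "realizable x' y'" and t: "0 \<le> t" "t \<le> 1"
  shows "realizable (t * x + (1 - t) * x') (t * y + (1 - t) * y')"
proof -
  obtain C where C: "copula C" "(\<lambda>u. C u u) integrable_on {0..1}"
    "(\<lambda>(u, v). C u v) integrable_on ({0..1} \<times> {0..1})"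
    "spearman_footrule C = x" "spearman_rho C = y"
    using assms(1) unfolding realizable_def by blast
  obtain D where D: "copula D" "(\<lambda>u. D u u) integrable_on {0..1}"
    "(\<lambda>(u, v). D u v) integrable_on ({0..1} \<times> {0..1})"
    "spearman_footrule D = x'" "spearman_rho D = y'"
    using assms(2) unfolding realizable_def by blast
  define M where "M = (\<lambda>u v. t * C u v + (1 - t) * D u v)"
  have diag: "((\<lambda>u. M u u) has_integral (t * integral {0..1} (\<lambda>u. C u u)
      + (1 - t) * integral {0..1} (\<lambda>u. D u u))) {0..1}"
    unfolding M_def using C(2) D(2)
    by (intro has_integral_add has_integral_mult_right integrable_integral)
  have "((\<lambda>z. t * (case z of (u, v) \<Rightarrow> C u v) + (1 - t) * (case z of (u, v) \<Rightarrow> D u v))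
      has_integral (t * integral ({0..1} \<times> {0..1}) (\<lambda>(u, v). C u v)
      + (1 - t) * integral ({0..1} \<times> {0..1}) (\<lambda>(u, v). D u v))) ({0..1} \<times> {0..1})"
    using C(3) D(3) by (intro has_integral_add has_integral_mult_right integrable_integral)
  then have square: "((\<lambda>(u, v). M u v) has_integral
      (t * integral ({0..1} \<times> {0..1}) (\<lambda>(u, v). C u v)
      + (1 - t) * integral ({0..1} \<times> {0..1}) (\<lambda>(u, v). D u v))) ({0..1} \<times> {0..1})"
    by (simp add: M_def case_prod_unfold)
  have "spearman_footrule M = t * x + (1 - t) * x'"
    unfolding C(4) [symmetric] D(4) [symmetric] spearman_footrule_def integral_unique [OF diag]
    by (simp add: algebra_simps)
  moreover have "spearman_rho M = t * y + (1 - t) * y'"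
    unfolding C(5) [symmetric] D(5) [symmetric] spearman_rho_def integral_unique [OF square]
    by (simp add: algebra_simps)
  moreover have "copula M"
    unfolding M_def using C(1) D(1) t by (rule copula_convex)
  ultimately show ?thesis
    unfolding realizable_def using diag square by (blast intro: has_integral_integrable)
qed

lemma realizable_chord:
  assumes "realizable c (f c)" "realizable d (f d)" "c \<le> x" "x \<le> d"
    and f: "\<And>z. f z = k * z + l"
  shows "realizable x (f x)"
proof (cases "c = d")
  case True
  then show ?thesis
    using assms by auto
next
  case False
  define t where "t = (d - x) / (d - c)"
  have t: "0 \<le> t" "t \<le> 1"
    using assms False by (auto simp: t_def divide_simps)
  have "t * (d - c) = d - x"
    using False by (simp add: t_def)
  then have x: "t * c + (1 - t) * d = x"
    by (simp add: algebra_simps)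
  have "t * f c + (1 - t) * f d = k * (t * c + (1 - t) * d) + l"
    by (simp add: f algebra_simps)
  then show ?thesis
    using realizable_convex [OF assms(1,2) t] unfolding x f by simp
qed

section \<open>Symmetric mixtures of segments\<close>

text \<open>
  Segment \<open>k\<close> runs from \<open>(a k, b k)\<close> to \<open>(a k + p k, b k + q k)\<close>, on or above the diagonal. It and
  its mirror image carry the mass \<open>w k\<close> each. Segments of mass \<open>0\<close> may be degenerate, so that a
  family of such couplings may be parametrized up to the values where a segment disappears. By
  symmetry, the last assumption says that both marginals are uniform.
\<close>

locale segment_coupling =
  fixes I :: "'i set" and w a p b q :: "'i \<Rightarrow> real"
  assumes finite_I: "finite I"
    and mass_nonneg: "k \<in> I \<Longrightarrow> 0 \<le> w k"
    and position: "\<lbrakk>k \<in> I; 0 < w k\<rbrakk> \<Longrightarrow> 0 \<le> a k \<and> 0 < p k \<and> 0 < q k \<and>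
          a k \<le> b k \<and> a k + p k \<le> b k + q k \<and> b k + q k \<le> 1"
    and marginal: "\<lbrakk>0 \<le> u; u \<le> 1\<rbrakk> \<Longrightarrow>
          (\<Sum>k\<in>I. w k * (ramp (a k) (p k) u + ramp (b k) (q k) u)) = u"
begin

definition mix :: "real \<Rightarrow> real \<Rightarrow> real" where
  "mix u v = (\<Sum>k\<in>I. w k * (segment (a k) (p k) (b k) (q k) u v
     + segment (a k) (p k) (b k) (q k) v u))"

text \<open>Where a segment has positive mass it may be treated as proper; otherwise its contribution
  vanishes.\<close>

lemma mass_cases:
  assumes "k \<in> I"
    and "\<lbrakk>0 < w k; 0 \<le> a k; 0 < p k; a k + p k \<le> 1; 0 \<le> b k; 0 < q k; b k + q k \<le> 1;
      a k \<le> b k; a k + p k \<le> b k + q k\<rbrakk> \<Longrightarrow> P"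
    and "w k = 0 \<Longrightarrow> P"
  shows P
  using assms mass_nonneg [of k] position [of k] by fastforce

lemma mix_sym: "mix u v = mix v u"
  by (simp add: mix_def add.commute)

lemma mix_zero:
  assumes "0 \<le> v" "v \<le> 1"
  shows "mix 0 v = 0"
  unfolding mix_def
proof (rule sum.neutral, rule ballI)
  fix k assume "k \<in> I"
  then show "w k * (segment (a k) (p k) (b k) (q k) 0 v
      + segment (a k) (p k) (b k) (q k) v 0) = 0"
    by (rule mass_cases) (auto simp: segment_def ramp_below ramp_bounds)
qed

lemma mix_one:
  assumes "0 \<le> v" "v \<le> 1"
  shows "mix 1 v = v"
proof -
  have "mix 1 v = (\<Sum>k\<in>I. w k * (ramp (a k) (p k) v + ramp (b k) (q k) v))"
    unfolding mix_def
  proof (rule sum.cong [OF refl])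
    fix k assume "k \<in> I"
    then show "w k * (segment (a k) (p k) (b k) (q k) 1 v + segment (a k) (p k) (b k) (q k) v 1)
        = w k * (ramp (a k) (p k) v + ramp (b k) (q k) v)"
      by (rule mass_cases) (auto simp: segment_def ramp_above ramp_bounds)
  qed
  then show ?thesis
    using marginal [OF assms] by simp
qed

lemma mix_rectangle:
  assumes "u1 \<le> u2" "v1 \<le> v2"
  shows "0 \<le> mix u2 v2 - mix u2 v1 - mix u1 v2 + mix u1 v1"
proof -
  let ?s = "\<lambda>k. segment (a k) (p k) (b k) (q k)"
  have "0 \<le> (\<Sum>k\<in>I. w k * ((?s k u2 v2 - ?s k u2 v1 - ?s k u1 v2 + ?s k u1 v1)
      + (?s k v2 u2 - ?s k v2 u1 - ?s k v1 u2 + ?s k v1 u1)))"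
  proof (rule sum_nonneg)
    fix k assume "k \<in> I"
    then show "0 \<le> w k * ((?s k u2 v2 - ?s k u2 v1 - ?s k u1 v2 + ?s k u1 v1)
      + (?s k v2 u2 - ?s k v2 u1 - ?s k v1 u2 + ?s k v1 u1))"
    proof (rule mass_cases)
      assume "0 < w k" "0 < p k" "0 < q k"
      then show ?thesis
        using assms
        by (intro mult_nonneg_nonneg add_nonneg_nonneg segment_rectangle) auto
    qed simp
  qed
  also have "\<dots> = mix u2 v2 - mix u2 v1 - mix u1 v2 + mix u1 v1"
    unfolding mix_def sum_subtractf [symmetric] sum.distrib [symmetric]
    by (rule sum.cong) (auto simp: algebra_simps)
  finally show ?thesis .
qed

lemma copula_mix: "copula mix"
proof -
  have "0 \<le> mix u v \<and> mix u v \<le> 1" if "u \<in> {0..1}" "v \<in> {0..1}" for u v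
  proof
    show "0 \<le> mix u v"
      using that mix_rectangle [of 0 u 0 v] mix_zero [of v] mix_zero [of u] mix_zero [of 0]
      by (auto simp: mix_sym [of u 0])
    show "mix u v \<le> 1"
      using that mix_rectangle [of u 1 0 v] mix_zero [of u] mix_zero [of 1] mix_one [of v]
      by (auto simp: mix_sym [of u 0] mix_sym [of 1 0])
  qed
  then show ?thesis
    unfolding copula_def
    using mix_zero mix_one mix_rectangle mix_sym [of _ 0] mix_sym [of _ 1] by auto
qed

lemma continuous_on_mix:
  "continuous_on S f \<Longrightarrow> continuous_on S g \<Longrightarrow> continuous_on S (\<lambda>x. mix (f x) (g x))"
  unfolding mix_def by (intro continuous_intros)

text \<open>Integrating the marginal condition gives \<open>E(1 - U) + E(1 - V) = 1\<close>.\<close>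

lemma first_moment:
  "(\<Sum>k\<in>I. w k * ((1 - a k - p k / 2) + (1 - b k - q k / 2))) = 1 / 2"
proof -
  have "((\<lambda>u. \<Sum>k\<in>I. w k * (ramp (a k) (p k) u + ramp (b k) (q k) u)) has_integral
      (\<Sum>k\<in>I. w k * ((1 - a k - p k / 2) + (1 - b k - q k / 2)))) {0..1}"
  proof (rule has_integral_sum [OF finite_I])
    fix k assume "k \<in> I"
    then show "((\<lambda>u. w k * (ramp (a k) (p k) u + ramp (b k) (q k) u)) has_integral
        w k * ((1 - a k - p k / 2) + (1 - b k - q k / 2))) {0..1}"
    proof (rule mass_cases)
      assume "0 \<le> a k" "0 < p k" "a k + p k \<le> 1" "0 \<le> b k" "0 < q k" "b k + q k \<le> 1"
      then show ?thesis
        by (intro has_integral_mult_right has_integral_add has_integral_ramp)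
    qed simp
  qed
  moreover have "((\<lambda>u. \<Sum>k\<in>I. w k * (ramp (a k) (p k) u + ramp (b k) (q k) u)) has_integral
      1 / 2) {0..1}"
  proof (rule has_integral_eq)
    show "((\<lambda>u. u) has_integral (1 / 2 :: real)) {0..1}"
      by (rule has_integral_antiderivative [where F = "\<lambda>u. u^2 / 2"])
        (auto intro!: derivative_eq_intros)
  qed (simp add: marginal)
  ultimately show ?thesis
    by (rule has_integral_unique)
qed

text \<open>Integrating the marginal condition against \<open>1 - u\<close> gives \<open>E(1 - U)\<^sup>2 + E(1 - V)\<^sup>2 = 2/3\<close>.\<close>

lemma second_moment:
  "(\<Sum>k\<in>I. w k * (((1 - a k)^2 - p k * (1 - a k) + (p k)^2 / 3)
      + ((1 - b k)^2 - q k * (1 - b k) + (q k)^2 / 3))) = 1 / 3"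
proof -
  let ?m = "\<lambda>a p :: real. ((1 - a)^2 - p * (1 - a) + p^2 / 3) / 2"
  have "((\<lambda>u. \<Sum>k\<in>I. w k * ((1 - u) * ramp (a k) (p k) u + (1 - u) * ramp (b k) (q k) u))
      has_integral (\<Sum>k\<in>I. w k * (?m (a k) (p k) + ?m (b k) (q k)))) {0..1}"
  proof (rule has_integral_sum [OF finite_I])
    fix k assume "k \<in> I"
    then show "((\<lambda>u. w k * ((1 - u) * ramp (a k) (p k) u + (1 - u) * ramp (b k) (q k) u))
        has_integral w k * (?m (a k) (p k) + ?m (b k) (q k))) {0..1}"
    proof (rule mass_cases)
      assume "0 \<le> a k" "0 < p k" "a k + p k \<le> 1" "0 \<le> b k" "0 < q k" "b k + q k \<le> 1"
      then show ?thesis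
        by (intro has_integral_mult_right has_integral_add has_integral_ramp_moment)
    qed simp
  qed
  moreover have "((\<lambda>u. \<Sum>k\<in>I. w k * ((1 - u) * ramp (a k) (p k) u
      + (1 - u) * ramp (b k) (q k) u)) has_integral 1 / 6) {0..1}"
  proof (rule has_integral_eq)
    show "((\<lambda>u. (1 - u) * u) has_integral (1 / 6 :: real)) {0..1}"
      by (rule has_integral_antiderivative [where F = "\<lambda>u. u^2 / 2 - u^3 / 3"])
        (auto intro!: derivative_eq_intros simp: power2_eq_square algebra_simps)
    fix u :: real assume "u \<in> {0..1}"
    then have "(1 - u) * u
        = (1 - u) * (\<Sum>k\<in>I. w k * (ramp (a k) (p k) u + ramp (b k) (q k) u))"
      by (simp add: marginal)
    also have "\<dots> = (\<Sum>k\<in>I. w k * ((1 - u) * ramp (a k) (p k) u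
        + (1 - u) * ramp (b k) (q k) u))"
      unfolding sum_distrib_left by (rule sum.cong) (auto simp: algebra_simps)
    finally show "(1 - u) * u = (\<Sum>k\<in>I. w k * ((1 - u) * ramp (a k) (p k) u
        + (1 - u) * ramp (b k) (q k) u))" .
  qed
  ultimately have "(\<Sum>k\<in>I. w k * (?m (a k) (p k) + ?m (b k) (q k))) = 1 / 6"
    by (rule has_integral_unique)
  then have "2 * (\<Sum>k\<in>I. w k * (?m (a k) (p k) + ?m (b k) (q k))) = 1 / 3"
    by simp
  then show ?thesis
    unfolding sum_distrib_left by (simp add: algebra_simps add_divide_distrib diff_divide_distrib)
qed

lemma integral_mix_diagonal:
  "integral {0..1} (\<lambda>u. mix u u) = (\<Sum>k\<in>I. w k * (2 * (1 - b k - q k / 2)))"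
  unfolding mix_def
proof (rule integral_unique, rule has_integral_sum [OF finite_I])
  fix k assume "k \<in> I"
  then show "((\<lambda>u. w k * (segment (a k) (p k) (b k) (q k) u u
      + segment (a k) (p k) (b k) (q k) u u)) has_integral w k * (2 * (1 - b k - q k / 2))) {0..1}"
  proof (rule mass_cases)
    assume k: "0 < p k" "0 < q k" "b k + q k \<le> 1" "0 \<le> b k" "a k \<le> b k" "a k + p k \<le> b k + q k"
    show ?thesis
      unfolding segment_diagonal [OF k(1,2,5,6)] mult_2
      by (intro has_integral_mult_right has_integral_add has_integral_ramp k)
  qed simp
qed

lemma integral_mix_square:
  "integral ({0..1} \<times> {0..1}) (\<lambda>(u, v). mix u v) = (\<Sum>k\<in>I. w k * (2 *
     ((1 - a k) * (1 - b k) - (q k * (1 - a k) + p k * (1 - b k)) / 2 + p k * q k / 3)))"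
proof -
  let ?A = "\<lambda>k. (1 - a k) * (1 - b k) - (q k * (1 - a k) + p k * (1 - b k)) / 2 + p k * q k / 3"
  let ?s = "\<lambda>k. segment (a k) (p k) (b k) (q k)"
  have seg: "((\<lambda>z. segment a p b q (fst z) (snd z)) has_integral
      integral ({0..1} \<times> {0..1}) (\<lambda>(u, v). segment a p b q u v)) ({0..1} \<times> {0..1})" for a p b q
  proof -
    have "(\<lambda>z. segment a p b q (fst z) (snd z)) integrable_on cbox (0, 0) (1, 1)"
      by (intro integrable_continuous continuous_intros)
    then show ?thesis
      by (simp add: cbox_Pair_eq case_prod_unfold integrable_integral)
  qed
  have "((\<lambda>z. \<Sum>k\<in>I. w k * (?s k (fst z) (snd z) + ?s k (snd z) (fst z)))
      has_integral (\<Sum>k\<in>I. w k * (2 * ?A k))) ({0..1} \<times> {0..1})"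
  proof (rule has_integral_sum [OF finite_I])
    fix k assume "k \<in> I"
    then show "((\<lambda>z. w k * (?s k (fst z) (snd z) + ?s k (snd z) (fst z)))
        has_integral w k * (2 * ?A k)) ({0..1} \<times> {0..1})"
    proof (rule mass_cases)
      assume k: "0 \<le> a k" "0 < p k" "a k + p k \<le> 1" "0 \<le> b k" "0 < q k" "b k + q k \<le> 1"
      have 1: "((\<lambda>z. ?s k (fst z) (snd z)) has_integral ?A k) ({0..1} \<times> {0..1})"
        using seg [of "a k" "p k" "b k" "q k"] integral_segment [OF k] by simp
      have "((\<lambda>z. segment (b k) (q k) (a k) (p k) (fst z) (snd z)) has_integral ?A k)
          ({0..1} \<times> {0..1})"
        using seg [of "b k" "q k" "a k" "p k"] integral_segment [OF k(4-6) k(1-3)]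
        by (simp add: algebra_simps)
      then have 2: "((\<lambda>z. ?s k (snd z) (fst z)) has_integral ?A k) ({0..1} \<times> {0..1})"
        by (simp only: segment_sym)
      show ?thesis
        unfolding mult_2 by (intro has_integral_mult_right has_integral_add 1 2)
    qed simp
  qed
  then show ?thesis
    unfolding mix_def case_prod_unfold by (rule integral_unique)
qed

text \<open>
  The two formulas are \<open>\<phi> = 1 - 3 E|U - V|\<close> and \<open>\<rho> = 1 - 6 E(U - V)\<^sup>2\<close>: along segment \<open>k\<close> the
  distance is \<open>(b k - a k) + (q k - p k) T\<close> with \<open>T\<close> uniform on the unit interval. They follow from
  the integrals of \<open>mix\<close> and the two moment identities, since with \<open>A = 1 - U\<close> and \<open>B = 1 - V\<close>
  above the diagonal \<open>2 B = A + B - (A - B)\<close> and \<open>2 A B = A\<^sup>2 + B\<^sup>2 - (A - B)\<^sup>2\<close>.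
\<close>

lemma realizable_mix:
  "realizable (1 - 6 * (\<Sum>k\<in>I. w k * ((b k - a k) + (q k - p k) / 2)))
     (1 - 12 * (\<Sum>k\<in>I. w k * ((b k - a k)^2 + (b k - a k) * (q k - p k) + (q k - p k)^2 / 3)))"
proof -
  have "integral {0..1} (\<lambda>u. mix u u)
      = (\<Sum>k\<in>I. w k * ((1 - a k - p k / 2) + (1 - b k - q k / 2)))
      - (\<Sum>k\<in>I. w k * ((b k - a k) + (q k - p k) / 2))"
    unfolding integral_mix_diagonal sum_subtractf [symmetric]
    by (rule sum.cong) (auto simp: field_simps)
  then have footrule:
    "spearman_footrule mix = 1 - 6 * (\<Sum>k\<in>I. w k * ((b k - a k) + (q k - p k) / 2))"
    unfolding spearman_footrule_def first_moment by simp
  have "integral ({0..1} \<times> {0..1}) (\<lambda>(u, v). mix u v)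
      = (\<Sum>k\<in>I. w k * (((1 - a k)^2 - p k * (1 - a k) + (p k)^2 / 3)
          + ((1 - b k)^2 - q k * (1 - b k) + (q k)^2 / 3)))
      - (\<Sum>k\<in>I. w k * ((b k - a k)^2 + (b k - a k) * (q k - p k) + (q k - p k)^2 / 3))"
    unfolding integral_mix_square sum_subtractf [symmetric]
    by (rule sum.cong) (auto simp: field_simps power2_eq_square)
  then have rho: "spearman_rho mix = 1 - 12 *
      (\<Sum>k\<in>I. w k * ((b k - a k)^2 + (b k - a k) * (q k - p k) + (q k - p k)^2 / 3))"
    unfolding spearman_rho_def second_moment by simp
  have "(\<lambda>u. mix u u) integrable_on {0..1}"
    by (intro integrable_continuous_real continuous_on_mix continuous_intros)
  moreover have "(\<lambda>z. mix (fst z) (snd z)) integrable_on cbox (0, 0) (1, 1)"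
    by (intro integrable_continuous continuous_on_mix continuous_intros)
  then have "(\<lambda>(u, v). mix u v) integrable_on ({0..1} \<times> {0..1})"
    by (simp add: cbox_Pair_eq case_prod_unfold)
  ultimately show ?thesis
    unfolding realizable_def using copula_mix footrule rho by blast
qed

end

section \<open>The extremal couplings\<close>

text \<open>A single segment on the diagonal: \<open>U = V\<close>.\<close>

lemma realizable_comonotone: "realizable 1 1"
proof -
  interpret segment_coupling "{0::nat}" "\<lambda>_. 1/2" "\<lambda>_. 0" "\<lambda>_. 1" "\<lambda>_. 0" "\<lambda>_. 1"
    by unfold_locales (auto simp: ramp_between)
  show ?thesis
    using realizable_mix by simp
qed

text \<open>Consecutive blocks of length \<open>h\<close>, taken in pairs, add up to Lebesgue measure on \<open>[0, 2nh]\<close>; for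
  \<open>h = 1/(2n)\<close> this is the whole unit interval.\<close>

lemma sum_ramp_blocks:
  assumes "0 < h" "0 \<le> u"
  shows "(\<Sum>k<n. h * (ramp (2 * real k * h) h u + ramp ((2 * real k + 1) * h) h u))
    = min u (2 * real n * h)"
proof (induction n)
  case 0
  then show ?case
    using assms by simp
next
  case (Suc n)
  have "min u (2 * real n * h) + h * ramp (2 * real n * h) h u = min u ((2 * real n + 1) * h)"
    using ramp_stack [of h u "2 * real n * h"] assms by (simp add: algebra_simps)
  moreover have "min u ((2 * real n + 1) * h) + h * ramp ((2 * real n + 1) * h) h u
      = min u (2 * real (Suc n) * h)"
    using ramp_stack [of h u "(2 * real n + 1) * h"] assms by (simp add: algebra_simps)
  ultimately show ?case
    unfolding sum.lessThan_Suc Suc.IH by (simp only: distrib_left)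
qed

lemma realizable_block_swap:
  assumes "1 \<le> n"
  shows "realizable (1 - 3 / (2 * real n)) (1 - 3 / (2 * (real n)^2))"
proof -
  define h where "h = 1 / (2 * real n)"
  have h: "0 < h" "2 * real n * h = 1"
    using assms by (auto simp: h_def)
  interpret segment_coupling "{..<n}" "\<lambda>_. h" "\<lambda>k. 2 * real k * h" "\<lambda>_. h"
    "\<lambda>k. (2 * real k + 1) * h" "\<lambda>_. h"
  proof
    fix k assume "k \<in> {..<n}"
    then have "(2 * real k + 2) * h \<le> 2 * real n * h"
      using h(1) by (intro mult_right_mono) auto
    then show "0 \<le> 2 * real k * h \<and> 0 < h \<and> 0 < h \<and> 2 * real k * h \<le> (2 * real k + 1) * h \<and>
        2 * real k * h + h \<le> (2 * real k + 1) * h + h \<and> (2 * real k + 1) * h + h \<le> 1"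
      using h by (simp add: algebra_simps)
  next
    fix u :: real assume "0 \<le> u" "u \<le> 1"
    then show "(\<Sum>k<n. h * (ramp (2 * real k * h) h u + ramp ((2 * real k + 1) * h) h u)) = u"
      using sum_ramp_blocks [OF h(1), of u n] h(2) by simp
  qed (use h in auto)
  have "(2 * real k + 1) * h - 2 * real k * h = h" for k
    by (simp add: algebra_simps)
  then have "realizable (1 - 6 * (real n * (h * h))) (1 - 12 * (real n * (h * h^2)))"
    using realizable_mix by simp
  moreover have "1 - 6 * (real n * (h * h)) = 1 - 3 / (2 * real n)"
    "1 - 12 * (real n * (h * h^2)) = 1 - 3 / (2 * (real n)^2)"
    using assms by (auto simp: h_def field_simps power2_eq_square)
  ultimately show ?thesis
    by simp
qed

text \<open>
  All mass of \<open>U\<close> on \<open>[0, (1 - s)/2]\<close> is sent upwards, all mass on \<open>[(1 + s)/2, 1]\<close> downwards, and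
  in the middle interval, of length \<open>s\<close>, half of the mass goes either way. The monotone transport of
  the mass sent upwards onto the mass received from below is then forced: it has slope \<open>2\<close> from
  \<open>[0, s/2]\<close> onto the middle interval, slope \<open>1\<close> from \<open>[s/2, (1 - s)/2]\<close> onto \<open>[(1 + s)/2, 1 - s/2]\<close>
  and slope \<open>1/2\<close> from the middle interval onto \<open>[1 - s/2, 1]\<close>. The distance \<open>V - U\<close> rises from
  \<open>(1 - s)/2\<close> to \<open>1/2\<close> along the first segment, equals \<open>1/2\<close> on the second, and falls back to
  \<open>(1 - s)/2\<close> along the third.
\<close>

lemma realizable_curve:
  assumes s: "0 \<le> s" "s \<le> 1/2"
  shows "realizable (3/2 * s^2 - 1/2) (3 * s^2 - s^3 - 1/2)"
proof -
  define w a p b q where wapbq: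
    "w = (\<lambda>k. [s/2, 1/2 - s, s/2] ! k)"
    "a = (\<lambda>k. [0, s/2, 1/2 - s/2] ! k)"
    "p = (\<lambda>k. [s/2, 1/2 - s, s] ! k)"
    "b = (\<lambda>k. [1/2 - s/2, 1/2 + s/2, 1 - s/2] ! k)"
    "q = (\<lambda>k. [s, 1/2 - s, s/2] ! k)"
  interpret segment_coupling "{..<3::nat}" w a p b q
  proof
    fix k :: nat assume "k \<in> {..<3}"
    then have k: "k = 0 \<or> k = 1 \<or> k = 2"
      by auto
    then show "0 \<le> w k"
      using s by (auto simp: wapbq)
    assume "0 < w k"
    with k show "0 \<le> a k \<and> 0 < p k \<and> 0 < q k \<and>
        a k \<le> b k \<and> a k + p k \<le> b k + q k \<and> b k + q k \<le> 1"
      using s by (auto simp: wapbq)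
  next
    fix u :: real assume u: "0 \<le> u" "u \<le> 1"
    have "(\<Sum>k<3. w k * (ramp (a k) (p k) u + ramp (b k) (q k) u))
        = s/2 * ramp 0 (s/2) u + (1/2 - s) * ramp (s/2) (1/2 - s) u
        + s * ramp (1/2 - s/2) s u
        + (1/2 - s) * ramp (1/2 + s/2) (1/2 - s) u + s/2 * ramp (1 - s/2) (s/2) u"
      by (simp add: wapbq eval_nat_numeral algebra_simps)
    also have "\<dots> = u"
      using s u ramp_stack [of "s/2" u 0] ramp_stack [of "1/2 - s" u "s/2"]
        ramp_stack [of s u "1/2 - s/2"] ramp_stack [of "1/2 - s" u "1/2 + s/2"]
        ramp_stack [of "s/2" u "1 - s/2"] by simp
    finally show "(\<Sum>k<3. w k * (ramp (a k) (p k) u + ramp (b k) (q k) u)) = u" .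
  qed simp
  have "(\<Sum>k<3. w k * ((b k - a k) + (q k - p k) / 2)) = 1/4 - s^2 / 4"
    by (simp add: wapbq eval_nat_numeral field_simps)
  moreover have "(\<Sum>k<3. w k * ((b k - a k)^2 + (b k - a k) * (q k - p k) + (q k - p k)^2 / 3))
      = 1/8 - s^2 / 4 + s^3 / 12"
    by (simp add: wapbq eval_nat_numeral field_simps)
  moreover have "1 - 6 * (1/4 - s^2 / 4) = 3/2 * s^2 - 1/2"
    "1 - 12 * (1/8 - s^2 / 4 + s^3 / 12) = 3 * s^2 - s^3 - 1/2"
    by simp_all
  ultimately show ?thesis
    using realizable_mix by (simp only:)
qed

section \<open>Realizing the graph of the function\<close>

lemma realizable_r_first:
  assumes x: "x \<in> {-1/2 .. -1/8}"
  shows "realizable x (r_fun x)"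
proof -
  define s where "s = sqrt ((1 + 2 * x) / 3)"
  have s2: "s^2 = (1 + 2 * x) / 3"
    using x by (simp add: s_def)
  have s: "0 \<le> s" "s \<le> 1/2"
  proof -
    show "0 \<le> s"
      using x by (simp add: s_def)
    have "s^2 \<le> (1/2)^2"
      unfolding s2 using x by (simp add: power2_eq_square)
    then show "s \<le> 1/2"
      by (rule power2_le_imp_le) simp
  qed
  have "(1 + 2 * x) powr (3/2) = (1 + 2 * x) powr 1 * (1 + 2 * x) powr (1/2)"
    by (simp only: powr_add [symmetric]) simp
  also have "\<dots> = (1 + 2 * x) * sqrt (1 + 2 * x)"
    using x by (simp add: powr_half_sqrt)
  also have "sqrt (1 + 2 * x) = sqrt 3 * s"
    by (simp add: s_def real_sqrt_divide)
  finally have "sqrt 3 / 9 * (1 + 2 * x) powr (3/2) = sqrt 3 / 9 * ((1 + 2 * x) * (sqrt 3 * s))"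
    by (simp only:)
  also have "\<dots> = (sqrt 3 * sqrt 3) * ((1 + 2 * x) * s) / 9"
    by (simp only: mult_ac times_divide_eq_left times_divide_eq_right)
  also have "\<dots> = (1 + 2 * x) / 3 * s"
    by simp
  also have "\<dots> = s^3"
    unfolding s2 [symmetric] by (simp add: power2_eq_square power3_eq_cube)
  finally have "r_fun x = 3 * s^2 - s^3 - 1/2"
    unfolding r_fun_first [OF x] s2 by simp
  moreover have "x = 3/2 * s^2 - 1/2"
    unfolding s2 by (simp add: field_simps)
  ultimately show ?thesis
    using realizable_curve [OF s] by simp
qed

lemma realizable_r_second:
  assumes x: "x \<in> {-1/8 .. 1/4}"
  shows "realizable x (r_fun x)"
proof -
  let ?f = "\<lambda>z :: real. 4/3 * z + 7/24"
  have "realizable (-1/8) (?f (-1/8))"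
    using realizable_r_first [of "-1/8"] by (simp add: r_fun_second)
  moreover have "realizable (1/4) (?f (1/4))"
    using realizable_block_swap [of 2] by simp
  ultimately have "realizable x (?f x)"
    by (rule realizable_chord [OF _ _ _ _ refl]) (use x in auto)
  then show ?thesis
    by (simp add: r_fun_second [OF x])
qed

lemma realizable_r_piece:
  assumes n: "2 \<le> n" and x: "x \<in> r_interval n"
  shows "realizable x (r_fun x)"
proof -
  let ?c = "1 - 3 / (2 * real n)" and ?d = "1 - 3 / (2 * (real n + 1))"
  have "realizable ?c (r_piece n ?c)"
    using realizable_block_swap [of n] r_piece_left [of n] n by simp
  moreover have "realizable ?d (r_piece n ?d)"
    using realizable_block_swap [of "Suc n"] r_piece_right [of n] n by (simp add: add.commute)
  ultimately have "realizable x (r_piece n x)"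
    by (rule realizable_chord [OF _ _ _ _ r_piece_def]) (use x in \<open>auto simp: r_interval_def\<close>)
  then show ?thesis
    by (simp add: r_fun_piece [OF n x])
qed

theorem proposition14:
  fixes x :: real
  assumes "x \<in> {-1/2 .. 1}"
  shows "\<exists>C. copula C \<and> spearman_footrule C = x \<and> spearman_rho C = r_fun x"
proof -
  have "realizable x (r_fun x)"
    using r_domain_cover [OF assms]
    by (elim disjE exE conjE)
      (simp_all add: realizable_r_first realizable_r_second realizable_r_piece
        realizable_comonotone r_fun_one)
  then show ?thesis
    unfolding realizable_def by blast
qed

end
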